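(* Let $T\ge 1$ be an integer, let $k\ge1$ be an integer with $k\le\frac12\log_2 T$, and let $0\le\delta\le\frac{1}{100k}$. Then there is no $(0.1,\delta)$-differentially private algorithm for the Threshold Monitor Problem with parameters $T,k$ that succeeds with probability at least $0.99$ on every input sequence in $\{0,1\}^T$.
   Context: Threshold Monitor Problem with parameters $T,k$: the threshold $k$ is fixed in advance. The input is a sequence $(\Delta_1,\dots,\Delta_T)\in\{0,1\}^T$. At each time step $t=1,\dots,T$ the (randomized) algorithm receives $\Delta_t$ and outputs $\top$ or $\bot$; let $n_t=\sum_{j=1}^t\Delta_j$. The algorithm is online: its outputs up to time $t$ depend only on $\Delta_1,\dots,\Delta_t$ and its internal randomness. The requirements are: if $n_t<\frac12k$ the algorithm reports $\bot$; if $n_t\ge k$ it reports $\top$; if $n_t\in[\frac12k,k)$ it may report either; once it reports $\top$, it halts (and produces no further outputs). The algorithm succeeds on a run if all of its responses up to and including the one at which it halts (or all $T$ responses, if it never reports $\top$) satisfy these requirements. Differential privacy: two input sequences in $\{0,1\}^T$ are neighboring if they differ in at most one coordinate. The algorithm is $(\varepsilon,\delta)$-differentially private if for all neighboring inputs $D,D'$ and every set $F$ of possible output sequences, $\Pr[\text{outputs on }D\in F]\le e^{\varepsilon}\Pr[\text{outputs on }D'\in F]+\delta$, where the output sequence is the entire sequence of responses. *)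

theory Defs
  imports "HOL-Probability.Probability"
begin

text \<open>
  Inputs are lists over \<open>{0, 1}\<close>. List positions are counted from 0, so \<open>\<Delta>\<^sub>t\<close> is \<open>D ! (t - 1)\<close>.
\<close>

definition binary_seqs :: "nat \<Rightarrow> nat list set" where
  "binary_seqs T = {D. length D = T \<and> set D \<subseteq> {0, 1}}"

definition neighboring :: "nat list \<Rightarrow> nat list \<Rightarrow> bool" where
  "neighboring D D' \<longleftrightarrow>
     length D = length D' \<and> card {i. i < length D \<and> D ! i \<noteq> D' ! i} \<le> 1"

datatype response = Top | Bot

text \<open>
  A randomized online algorithm with internal randomness drawn from \<open>M\<close> is a map \<open>A\<close>, where
  \<open>A \<omega> [\<Delta>\<^sub>1, \<dots>, \<Delta>\<^sub>t]\<close> is the response at time \<open>t\<close> if the algorithm has not halted before.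
  Passing only this prefix to \<open>A\<close> makes the algorithm online. The values of \<open>A\<close> after the
  first \<^const>\<open>Top\<close> are irrelevant, since \<open>output_seq\<close> below discards them.
\<close>

definition online_algorithm ::
    "nat \<Rightarrow> 'w measure \<Rightarrow> ('w \<Rightarrow> nat list \<Rightarrow> response) \<Rightarrow> bool" where
  "online_algorithm T M A \<longleftrightarrow>
     prob_space M \<and>
     (\<forall>D \<in> binary_seqs T. \<forall>t \<in> {1..T}.
        (\<lambda>\<omega>. A \<omega> (take t D)) \<in> measurable M (count_space UNIV))"

primrec halt_at_top :: "response list \<Rightarrow> response list" where
  "halt_at_top [] = []"
| "halt_at_top (r # rs) = (if r = Top then [Top] else r # halt_at_top rs)"

definition output_seq ::
    "('w \<Rightarrow> nat list \<Rightarrow> response) \<Rightarrow> nat list \<Rightarrow> 'w \<Rightarrow> response list" where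
  "output_seq A D \<omega> = halt_at_top (map (\<lambda>t. A \<omega> (take t D)) [1..<Suc (length D)])"

definition valid_responses :: "nat \<Rightarrow> nat list \<Rightarrow> response list \<Rightarrow> bool" where
  "valid_responses k D rs \<longleftrightarrow>
     (\<forall>t \<in> {1..length rs}.
        let n = sum_list (take t D); r = rs ! (t - 1) in
          (real n < real k / 2 \<longrightarrow> r = Bot) \<and> (n \<ge> k \<longrightarrow> r = Top))"

definition solves_threshold_monitor ::
    "nat \<Rightarrow> nat \<Rightarrow> real \<Rightarrow> 'w measure \<Rightarrow> ('w \<Rightarrow> nat list \<Rightarrow> response) \<Rightarrow> bool" where
  "solves_threshold_monitor T k p M A \<longleftrightarrow>
     (\<forall>D \<in> binary_seqs T.
        measure M {\<omega> \<in> space M. valid_responses k D (output_seq A D \<omega>)} \<ge> p)"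

definition differentially_private ::
    "nat \<Rightarrow> real \<Rightarrow> real \<Rightarrow> 'w measure \<Rightarrow> ('w \<Rightarrow> nat list \<Rightarrow> response) \<Rightarrow> bool" where
  "differentially_private T \<epsilon> \<delta> M A \<longleftrightarrow>
     (\<forall>D \<in> binary_seqs T. \<forall>D' \<in> binary_seqs T. neighboring D D' \<longrightarrow>
        (\<forall>F. measure M {\<omega> \<in> space M. output_seq A D \<omega> \<in> F}
             \<le> exp \<epsilon> * measure M {\<omega> \<in> space M. output_seq A D' \<omega> \<in> F} + \<delta>))"

end

theory Submission
  imports Defs
begin

text \<open>
  Starting from the all-zero input, ones are inserted one at a time from left to right while a
  window of times shrinks. Halve the window, keep the half \<open>J\<close> in which the algorithm is less
  likely to halt, and insert the next one at the start of \<open>J\<close>. Since the algorithm is online, the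
  probability of halting before \<open>J\<close> does not change; by privacy, the probability of halting
  inside \<open>J\<close> grows by at most a factor \<open>exp \<epsilon>\<close> plus \<open>\<delta>\<close>, which the halving
  more than compensates. Hence with \<open>k\<close> ones inserted the probability of having halted is still
  \<open>O(k \<delta> + 0.01)\<close>, although the \<open>k\<close>-th one must trigger \<^const>\<open>Top\<close>.
\<close>

section \<open>Output sequences of halting runs\<close>

text \<open>The index \<open>j\<close> is a list position, so this output belongs to a run that
  halts at time \<open>j + 1\<close>. Sets of positions then serve as windows of both inputs and
  outputs.\<close>

definition top_at :: "nat \<Rightarrow> response list" where
  "top_at j = replicate j Bot @ [Top]"

lemma top_at_simps [simp]:
  "length (top_at j) = Suc j" "top_at j ! j = Top" "i < j \<Longrightarrow> top_at j ! i = Bot"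
  by (auto simp: top_at_def nth_append)

lemma inj_top_at: "inj top_at"
  by (rule injI) (metis nat.inject top_at_simps(1))

lemma halt_at_top_eq_top_at_iff:
  "halt_at_top rs = top_at j \<longleftrightarrow> j < length rs \<and> (\<forall>i<j. rs ! i = Bot) \<and> rs ! j = Top"
proof (induction rs arbitrary: j)
  case (Cons r rs)
  show ?case
  proof (cases j)
    case 0
    then show ?thesis by (cases r) (auto simp: top_at_def)
  next
    case (Suc i)
    then show ?thesis
      using Cons[of i] by (cases r) (auto simp: top_at_def All_less_Suc2)
  qed
qed (simp add: top_at_def)

lemma halt_at_top_cases:
  obtains j where "j < length rs" "halt_at_top rs = top_at j"
  | "halt_at_top rs = replicate (length rs) Bot"
proof -
  have "(\<exists>j<length rs. halt_at_top rs = top_at j) \<or> halt_at_top rs = replicate (length rs) Bot"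
  proof (induction rs)
    case (Cons r rs)
    then show ?case
      by (cases r) (force simp: top_at_def)+
  qed simp
  with that show thesis by blast
qed

lemma output_seq_eq_top_at_iff:
  "output_seq A D \<omega> = top_at j \<longleftrightarrow>
     j < length D \<and> (\<forall>i<j. A \<omega> (take (Suc i) D) = Bot) \<and> A \<omega> (take (Suc j) D) = Top"
  by (auto simp: output_seq_def halt_at_top_eq_top_at_iff nth_append simp del: upt_Suc)

section \<open>Inputs padded with zeros\<close>

definition pad_zeros :: "nat \<Rightarrow> nat list \<Rightarrow> nat list" where
  "pad_zeros T xs = xs @ replicate (T - length xs) 0"

lemma pad_zeros_binary: "set xs \<subseteq> {0, 1} \<Longrightarrow> length xs \<le> T \<Longrightarrow> pad_zeros T xs \<in> binary_seqs T"
  by (auto simp: pad_zeros_def binary_seqs_def)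

text \<open>Lengthening the fixed prefix changes a single coordinate of the padded input, so privacy
  applies to each insertion.\<close>

lemma pad_zeros_snoc_one:
  assumes "length xs + n < T"
  shows "pad_zeros T (xs @ replicate n 0 @ [1]) = (pad_zeros T xs)[length xs + n := 1]"
proof -
  have "replicate (T - length xs) (0::nat) = replicate n 0 @ 0 # replicate (T - Suc (length xs + n)) 0"
    using assms by (simp flip: replicate_Suc replicate_add)
  then show ?thesis
    by (simp add: pad_zeros_def list_update_append)
qed

lemma neighboring_list_update: "neighboring D (D[i := x])"
proof -
  have "card {j. j < length D \<and> D ! j \<noteq> D[i := x] ! j} \<le> card {i}"
    by (rule card_mono) (auto, metis nth_list_update_neq)
  then show ?thesis
    by (simp add: neighboring_def)
qed

section \<open>Halting probabilities\<close>

locale online_prob_algorithm =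
  fixes T :: nat and M :: "'w measure" and A :: "'w \<Rightarrow> nat list \<Rightarrow> response"
  assumes online: "online_algorithm T M A"
begin

sublocale prob_space M
  using online by (simp add: online_algorithm_def)

definition halt_prob :: "nat list \<Rightarrow> nat set \<Rightarrow> real" where
  "halt_prob D S = prob {\<omega> \<in> space M. output_seq A D \<omega> \<in> top_at ` S}"

lemma halt_event_measurable:
  assumes D: "D \<in> binary_seqs T"
  shows "{\<omega> \<in> space M. output_seq A D \<omega> \<in> top_at ` S} \<in> events"
proof -
  have A: "(\<lambda>\<omega>. A \<omega> (take (Suc i) D)) \<in> measurable M (count_space UNIV)" if "i < T" for i
    using online D that by (auto simp: online_algorithm_def)
  have *: "{\<omega> \<in> space M. A \<omega> (take (Suc i) D) = r} \<in> events" if "i < T" for i r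
    using measurable_sets[OF A[OF that], of "{r}"] by (simp add: vimage_def Int_def conj_commute)
  have len: "length D = T"
    using D by (simp add: binary_seqs_def)
  have "{\<omega> \<in> space M. output_seq A D \<omega> = top_at j} \<in> events" for j
  proof (cases "j < T")
    case True
    have "{\<omega> \<in> space M. (\<forall>i\<in>{..<j}. A \<omega> (take (Suc i) D) = Bot) \<and> A \<omega> (take (Suc j) D) = Top}
            \<in> events"
      using True by (intro sets.sets_Collect_conj sets.sets_Collect_finite_All * ) auto
    also have "{\<omega> \<in> space M. (\<forall>i\<in>{..<j}. A \<omega> (take (Suc i) D) = Bot) \<and> A \<omega> (take (Suc j) D) = Top} =
        {\<omega> \<in> space M. output_seq A D \<omega> = top_at j}"
      using True len by (auto simp: output_seq_eq_top_at_iff)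
    finally show ?thesis .
  qed (simp add: output_seq_eq_top_at_iff len)
  then have "(\<Union>j\<in>S. {\<omega> \<in> space M. output_seq A D \<omega> = top_at j}) \<in> events"
    by (intro sets.countable_UN') auto
  also have "(\<Union>j\<in>S. {\<omega> \<in> space M. output_seq A D \<omega> = top_at j}) =
      {\<omega> \<in> space M. output_seq A D \<omega> \<in> top_at ` S}"
    by auto
  finally show ?thesis .
qed

lemma halt_prob_nonneg: "0 \<le> halt_prob D S"
  by (simp add: halt_prob_def)

lemma halt_prob_mono:
  "D \<in> binary_seqs T \<Longrightarrow> S \<subseteq> S' \<Longrightarrow> halt_prob D S \<le> halt_prob D S'"
  unfolding halt_prob_def by (intro finite_measure_mono halt_event_measurable) auto

lemma halt_prob_add:
  assumes "D \<in> binary_seqs T" "a \<le> b" "b \<le> c"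
  shows "halt_prob D {a..<c} = halt_prob D {a..<b} + halt_prob D {b..<c}"
proof -
  have "halt_prob D {a..<c} =
      prob ({\<omega> \<in> space M. output_seq A D \<omega> \<in> top_at ` {a..<b}} \<union>
            {\<omega> \<in> space M. output_seq A D \<omega> \<in> top_at ` {b..<c}})"
    unfolding halt_prob_def ivl_disj_un_two(3)[OF assms(2,3), symmetric]
    by (rule arg_cong[where f = prob]) auto
  also have "\<dots> = halt_prob D {a..<b} + halt_prob D {b..<c}"
    unfolding halt_prob_def
    by (rule finite_measure_Union) (auto intro!: halt_event_measurable assms simp: inj_eq[OF inj_top_at])
  finally show ?thesis .
qed

text \<open>This is where the online property enters: whether the run halts at a position
  \<open>j < a\<close> is decided by the first \<open>a\<close> entries.\<close>

lemma halt_prob_cong_prefix: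
  assumes "take a D = take a D'" "length D = length D'"
  shows "halt_prob D {0..<a} = halt_prob D' {0..<a}"
proof -
  have "take (Suc i) D = take (Suc i) D'" if "i < a" for i
    using arg_cong[OF assms(1), of "take (Suc i)"] that by (simp add: min_def)
  then have "output_seq A D \<omega> = top_at j \<longleftrightarrow> output_seq A D' \<omega> = top_at j" if "j < a" for j \<omega>
    using that assms(2) by (simp add: output_seq_eq_top_at_iff)
  then show ?thesis
    unfolding halt_prob_def image_iff by (metis (no_types, lifting) atLeastLessThan_iff)
qed

lemma halt_prob_update:
  assumes dp: "differentially_private T \<epsilon> \<delta> M A"
    and "D \<in> binary_seqs T" "D[i := x] \<in> binary_seqs T"
  shows "halt_prob (D[i := x]) S \<le> exp \<epsilon> * halt_prob D S + \<delta>"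
proof -
  have "neighboring (D[i := x]) D"
    using neighboring_list_update[of "D[i := x]" i "D ! i"] by simp
  then show ?thesis
    using assms unfolding differentially_private_def halt_prob_def by blast
qed

section \<open>Inserting ones into a shrinking window\<close>

text \<open>
  The weight \<open>1/4\<close> of the window makes the potential insensitive to the multiplicative loss:
  if \<open>m\<close> is the window's halting probability, an insertion adds at most
  \<open>(c - 1) m / 2 + \<delta>\<close> to the first term and turns \<open>m\<close> into at most \<open>c m / 2 + \<delta>\<close>,
  where \<open>c = exp \<epsilon>\<close>, and \<open>(c - 1) / 2 + c / 8 \<le> 1 / 4\<close> for \<open>c \<le> 6 / 5\<close>.
\<close>
definition potential :: "nat list \<Rightarrow> nat \<Rightarrow> real" where
  "potential xs L =
     halt_prob (pad_zeros T xs) {0..<length xs + L} +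
     halt_prob (pad_zeros T xs) {length xs..<length xs + L} / 4"

lemma potential_insert_one:
  assumes dp: "differentially_private T \<epsilon> \<delta> M A" and eps: "exp \<epsilon> \<le> 6 / 5"
    and xs: "set xs \<subseteq> {0, 1}" and h: "0 < h" "length xs + 2 * h \<le> T"
  obtains n where "n \<le> h"
    "potential (xs @ replicate n 0 @ [1]) (h - 1) \<le> potential xs (2 * h) + 5 / 4 * \<delta>"
proof -
  define a D where "a = length xs" and "D = pad_zeros T xs"
  have D: "D \<in> binary_seqs T"
    unfolding D_def using xs h by (intro pad_zeros_binary) auto
  define m where "m = halt_prob D {a..<a + 2 * h}"
  have m: "m = halt_prob D {a..<a + h} + halt_prob D {a + h..<a + 2 * h}"
    unfolding m_def by (rule halt_prob_add[OF D]) auto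
  \<comment> \<open>The two halves share the mass \<open>m\<close>, so one of them has at most
    \<open>m / 2\<close>; \<open>n\<close> is the offset of that half.\<close>
  obtain n where n: "n \<in> {0, h}" and half: "halt_prob D {a + n..<a + n + h} \<le> m / 2"
  proof (cases "halt_prob D {a..<a + h} \<le> m / 2")
    case True
    then show thesis by (intro that[of 0]) auto
  next
    case False
    then show thesis using m by (intro that[of h]) (auto simp: mult_2 add.assoc)
  qed
  define c D' where "c = a + n" and "D' = D[c := 1]"
  have c: "c + h \<le> a + 2 * h"
    using n by (auto simp: c_def)
  have D'_eq: "D' = pad_zeros T (xs @ replicate n 0 @ [1])"
    unfolding D'_def D_def c_def a_def using n h by (subst pad_zeros_snoc_one) auto
  have D': "D' \<in> binary_seqs T"
    unfolding D'_eq using xs n h by (intro pad_zeros_binary) (auto simp: set_replicate_conv_if)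
  \<comment> \<open>The inserted one uses up position \<open>c\<close>, so the next window starts at
    \<open>Suc c\<close> and has length \<open>h - 1\<close>.\<close>
  have len: "length (xs @ replicate n 0 @ [1]) = Suc c"
    by (simp add: c_def a_def)
  define m\<^sub>J where "m\<^sub>J = halt_prob D {c..<c + h}"
  have mJ: "m\<^sub>J \<le> m / 2" "0 \<le> m\<^sub>J"
    using half by (simp_all add: m\<^sub>J_def c_def halt_prob_nonneg)
  have window: "halt_prob D' {c..<c + h} \<le> exp \<epsilon> * m\<^sub>J + \<delta>"
    unfolding D'_def m\<^sub>J_def using D D' by (intro halt_prob_update[OF dp]) (auto simp: D'_def)
  have "halt_prob D' {0..<c + h} = halt_prob D {0..<c} + halt_prob D' {c..<c + h}"
  proof -
    have "halt_prob D' {0..<c} = halt_prob D {0..<c}"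
      by (rule halt_prob_cong_prefix) (auto simp: D'_def)
    then show ?thesis using halt_prob_add[OF D', of 0 c "c + h"] by simp
  qed
  moreover have "halt_prob D {0..<c} + m\<^sub>J \<le> halt_prob D {0..<a + 2 * h}"
    using halt_prob_add[OF D, of 0 c "c + h"] halt_prob_mono[OF D, of "{0..<c + h}" "{0..<a + 2 * h}"] c
    by (simp add: m\<^sub>J_def)
  moreover have "halt_prob D' {Suc c..<c + h} \<le> halt_prob D' {c..<c + h}"
    by (rule halt_prob_mono[OF D']) auto
  moreover have "exp \<epsilon> * m\<^sub>J \<le> 6 / 5 * m\<^sub>J"
    using mJ eps by (intro mult_right_mono) auto
  ultimately have "halt_prob D' {0..<c + h} + halt_prob D' {Suc c..<c + h} / 4
      \<le> halt_prob D {0..<a + 2 * h} + m / 4 + 5 / 4 * \<delta>"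
    using window mJ by linarith
  then have "potential (xs @ replicate n 0 @ [1]) (h - 1) \<le> potential xs (2 * h) + 5 / 4 * \<delta>"
    using h(1) unfolding potential_def len D'_eq[symmetric] by (simp add: m_def a_def D_def)
  moreover have "n \<le> h" using n by auto
  ultimately show thesis using that by blast
qed

text \<open>The lengths \<open>2 ^ (k + 1 - i) - 2\<close> solve the recursion from
  \<open>2 * h\<close> to \<open>h - 1\<close> and reach 0 exactly at \<open>i = k\<close>.\<close>

lemma exists_low_potential_input:
  assumes dp: "differentially_private T \<epsilon> \<delta> M A" and eps: "exp \<epsilon> \<le> 6 / 5"
    and T: "2 ^ (k + 1) - 2 \<le> T" and "i \<le> k"
  shows "\<exists>xs. set xs \<subseteq> {0, 1} \<and> sum_list xs = i \<and> length xs + (2 ^ (k + 1 - i) - 2) \<le> T \<and>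
    potential xs (2 ^ (k + 1 - i) - 2) \<le> potential [] (2 ^ (k + 1) - 2) + 5 / 4 * real i * \<delta>"
  using \<open>i \<le> k\<close>
proof (induction i)
  case 0
  then show ?case using T by (intro exI[of _ "[]"]) auto
next
  case (Suc i)
  define h where "h = (2 ^ (k - i) - 1 :: nat)"
  \<comment> \<open>As \<open>i < k\<close>, the window is nonempty before this insertion, and the
    truncated subtractions are exact.\<close>
  have "(2::nat) ^ 1 \<le> 2 ^ (k - i)"
    using Suc.prems by (intro power_increasing) auto
  then have h: "0 < h" "2 ^ (k + 1 - i) - 2 = 2 * h" "2 ^ (k + 1 - Suc i) - 2 = h - 1"
    using Suc.prems by (auto simp: h_def Suc_diff_le)
  from Suc obtain xs where xs: "set xs \<subseteq> {0, 1}" "sum_list xs = i" "length xs + 2 * h \<le> T"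
    "potential xs (2 * h) \<le> potential [] (2 ^ (k + 1) - 2) + 5 / 4 * real i * \<delta>"
    unfolding h(2) by auto
  obtain n where n: "n \<le> h"
    "potential (xs @ replicate n 0 @ [1]) (h - 1) \<le> potential xs (2 * h) + 5 / 4 * \<delta>"
    using potential_insert_one[OF dp eps xs(1) h(1) xs(3)] .
  have "potential (xs @ replicate n 0 @ [1]) (h - 1) \<le>
      potential [] (2 ^ (k + 1) - 2) + 5 / 4 * real (Suc i) * \<delta>"
    using n(2) xs(4) by (simp add: field_simps)
  moreover have "length (xs @ replicate n 0 @ [1]) + (h - 1) \<le> T"
    using n(1) xs(3) h(1) by simp
  ultimately show ?case
    unfolding h(3) using xs(1,2)
    by (intro exI[of _ "xs @ replicate n 0 @ [1]"])
      (auto simp: set_replicate_conv_if sum_list_replicate)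
qed

section \<open>Correctness at both extremes and the contradiction\<close>

lemma halt_prob_zeros:
  assumes solves: "solves_threshold_monitor T k p M A" and "0 < p" "1 \<le> k"
  shows "halt_prob (pad_zeros T []) {0..<T} \<le> 1 - p"
proof -
  let ?D = "pad_zeros T []"
  let ?V = "{\<omega> \<in> space M. valid_responses k ?D (output_seq A ?D \<omega>)}"
  let ?H = "{\<omega> \<in> space M. output_seq A ?D \<omega> \<in> top_at ` {0..<T}}"
  have D: "?D \<in> binary_seqs T" by (rule pad_zeros_binary) auto
  have V: "p \<le> prob ?V"
    using solves D by (simp add: solves_threshold_monitor_def)
  \<comment> \<open>A set outside the sigma-algebra has measure 0 by convention, which
    \<open>0 < p\<close> rules out.\<close>
  then have "?V \<in> events"
    using \<open>0 < p\<close> measure_notin_sets[of ?V M] by force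
  \<comment> \<open>On the zero input every count is 0, below \<open>k / 2\<close>, so any
    \<open>Top\<close> is an error.\<close>
  moreover have "\<not> valid_responses k ?D (top_at j)" for j
    using \<open>1 \<le> k\<close>
    by (auto simp: valid_responses_def pad_zeros_def sum_list_replicate Let_def intro!: bexI[of _ "Suc j"])
  then have "?V \<inter> ?H = {}" by auto
  ultimately have "prob ?V + prob ?H = prob (?V \<union> ?H)"
    using halt_event_measurable[OF D] by (simp add: finite_measure_Union)
  also have "\<dots> \<le> 1" by (rule prob_le_1)
  finally show ?thesis using V by (simp add: halt_prob_def)
qed

text \<open>A valid run that is still active at time \<open>a\<close> must answer \<open>Top\<close>
  there, so it halts at a position below \<open>a\<close>.\<close>

lemma halt_prob_threshold:
  assumes solves: "solves_threshold_monitor T k p M A" and D: "D \<in> binary_seqs T"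
    and a: "0 < a" "a \<le> T" and sum: "k \<le> sum_list (take a D)"
  shows "p \<le> halt_prob D {0..<a}"
proof -
  have len: "length D = T" using D by (simp add: binary_seqs_def)
  have halt: "rs \<in> top_at ` {0..<a}"
    if valid: "valid_responses k D rs" and rs: "rs = output_seq A D \<omega>" for rs \<omega>
  proof -
    have top: "rs ! (a - 1) = Top" if "a \<le> length rs"
      using valid that a sum by (auto simp: valid_responses_def Let_def)
    let ?qs = "map (\<lambda>t. A \<omega> (take t D)) [1..<Suc (length D)]"
    have rs': "rs = halt_at_top ?qs" by (simp add: rs output_seq_def)
    show ?thesis
    proof (cases ?qs rule: halt_at_top_cases)
      case (1 j)
      then have j: "rs = top_at j" using rs' by simp
      have "j < a"
      proof (rule ccontr)
        assume "\<not> j < a"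
        then have "rs ! (a - 1) = Bot" using a by (simp add: j)
        then show False using top \<open>\<not> j < a\<close> by (simp add: j)
      qed
      then show ?thesis using j by auto
    next
      case 2
      then have "rs = replicate T Bot" using rs' len by simp
      then show ?thesis using top a by auto
    qed
  qed
  have "p \<le> prob {\<omega> \<in> space M. valid_responses k D (output_seq A D \<omega>)}"
    using solves D by (simp add: solves_threshold_monitor_def)
  also have "\<dots> \<le> halt_prob D {0..<a}"
    unfolding halt_prob_def using halt by (intro finite_measure_mono halt_event_measurable D) auto
  finally show ?thesis .
qed

lemma not_private_solver:
  assumes dp: "differentially_private T \<epsilon> \<delta> M A" and eps: "exp \<epsilon> \<le> 6 / 5"
    and solves: "solves_threshold_monitor T k p M A" and p: "0 < p"
    and k: "1 \<le> k" "2 ^ (k + 1) - 2 \<le> T"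
  shows "p \<le> 5 / 4 * (1 - p) + 5 / 4 * real k * \<delta>"
proof -
  obtain xs where xs: "set xs \<subseteq> {0, 1}" "sum_list xs = k" "length xs \<le> T"
    "potential xs 0 \<le> potential [] (2 ^ (k + 1) - 2) + 5 / 4 * real k * \<delta>"
    using exists_low_potential_input[OF dp eps k(2), of k] by auto
  have "0 < length xs" using xs(2) k(1) by (cases xs) auto
  then have "p \<le> halt_prob (pad_zeros T xs) {0..<length xs}"
    using xs by (intro halt_prob_threshold[OF solves] pad_zeros_binary) (auto simp: pad_zeros_def)
  also have "\<dots> \<le> potential xs 0"
    by (simp add: potential_def halt_prob_nonneg)
  also note xs(4)
  \<comment> \<open>Initially prefix and window are the same interval, whence the factor
    \<open>1 + 1 / 4\<close>.\<close>
  also have "potential [] (2 ^ (k + 1) - 2) \<le> 5 / 4 * halt_prob (pad_zeros T []) {0..<T}"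
    using halt_prob_mono[of "pad_zeros T []" "{0..<2 ^ (k + 1) - 2}" "{0..<T}"] k(2)
      pad_zeros_binary[of "[]" T]
    by (simp add: potential_def)
  also have "\<dots> \<le> 5 / 4 * (1 - p)"
    using halt_prob_zeros[OF solves p k(1)] by simp
  finally show ?thesis by simp
qed

end

theorem theorem7:
  fixes T k :: nat and \<delta> :: real
  assumes "T \<ge> 1" and "k \<ge> 1" and "real k \<le> 1 / 2 * log 2 (real T)"
    and "0 \<le> \<delta>" and "\<delta> \<le> 1 / (100 * real k)"
  shows "\<not> (\<exists>(M :: 'w measure) A.
           online_algorithm T M A \<and>
           differentially_private T 0.1 \<delta> M A \<and>
           solves_threshold_monitor T k 0.99 M A)"
proof (intro notI, elim exE conjE)
  fix M :: "'w measure" and A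
  assume A: "online_algorithm T M A" "differentially_private T 0.1 \<delta> M A"
    "solves_threshold_monitor T k 0.99 M A"
  interpret online_prob_algorithm T M A
    by standard (rule A(1))
  have "real (2 * k) \<le> log 2 (real T)" using assms(3) by simp
  then have "2 powr real (2 * k) \<le> real T"
    using assms(1) by (subst (asm) le_log_iff) auto
  then have "real (2 ^ (2 * k)) \<le> real T"
    by (subst (asm) powr_realpow) auto
  then have "2 ^ (2 * k) \<le> T" by (simp only: of_nat_le_iff)
  \<comment> \<open>The initial window fits since \<open>k + 1 \<le> 2 * k\<close> for
    \<open>k \<ge> 1\<close>.\<close>
  moreover have "(2::nat) ^ (k + 1) \<le> 2 ^ (2 * k)"
    using assms(2) by (intro power_increasing) auto
  ultimately have T: "2 ^ (k + 1) - 2 \<le> T" by linarith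
  \<comment> \<open>Inverting this gives \<open>exp 0.1 \<le> 10 / 9\<close>, which is below
    \<open>6 / 5\<close>.\<close>
  have "1 - 0.1 \<le> exp (- 0.1 :: real)"
    using exp_ge_add_one_self[of "- 0.1"] by simp
  then have "exp (0.1 :: real) \<le> 6 / 5"
    by (simp add: exp_minus field_simps)
  from not_private_solver[OF A(2) this A(3) _ assms(2) T]
  have "0.99 \<le> 5 / 4 * (1 - 0.99) + 5 / 4 * real k * \<delta>" by simp
  \<comment> \<open>Both summands on the right are now at most 0.0125, far below 0.99 in
    total.\<close>
  moreover have "real k * \<delta> \<le> 1 / 100"
    using mult_left_mono[OF assms(5), of "real k"] assms(2) by simp
  ultimately show False by (simp add: mult.commute)
qed

end
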